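(* Let $X$ be a geodesic metric space. Then $X$ is a real tree if and only if $$\sup\left\{\frac{\delta(\Delta)}{\mathrm{pr}(\Delta)}:\ \Delta \text{ a triangle in } X \text{ with } \mathrm{pr}(\Delta)>0\right\}<\frac{1}{32},$$ where the supremum of the empty set is taken to be $0$.
   Context: Let $(X,d)$ be a metric space. A map $\gamma\colon[0,1]\to X$ is a geodesic if there is $k\ge 0$ with $d(\gamma(t),\gamma(s))=k|t-s|$ for all $t,s\in[0,1]$; geodesics are identified with their images. $X$ is geodesic if any two of its points can be joined by a geodesic. A triangle $\Delta=\Delta(x,y,z)$ with vertices $x,y,z$ is the union of three geodesics $[x,y],[y,z],[z,x]$ (its sides) joining the vertices pairwise; its perimeter is $\mathrm{pr}(\Delta)=d(x,y)+d(y,z)+d(z,x)$. A triangle with sides $\ell_1,\ell_2,\ell_3$ satisfies the Rips condition with constant $\delta$ if, whenever $\{i,j,k\}=\{1,2,3\}$, every point of $\ell_i$ is at distance at most $\delta$ from $\ell_j\cup\ell_k$. A geodesic space is $\delta$-hyperbolic if every triangle in it satisfies the Rips condition with constant $\delta$; a real tree is a $0$-hyperbolic geodesic space. For a triangle $\Delta$ let $\delta(\Delta)=\inf\{\delta:\ \Delta \text{ satisfies the Rips condition with constant } \delta\}$. *)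

theory Defs
  imports "HOL-Analysis.Abstract_Metric_Spaces"
begin

definition is_geodesic :: "'a set \<Rightarrow> ('a \<Rightarrow> 'a \<Rightarrow> real) \<Rightarrow> (real \<Rightarrow> 'a) \<Rightarrow> bool" where
  "is_geodesic M d g \<longleftrightarrow> g ` {0..1} \<subseteq> M \<and>
     (\<exists>k\<ge>0. \<forall>t\<in>{0..1}. \<forall>s\<in>{0..1}. d (g t) (g s) = k * \<bar>t - s\<bar>)"

text \<open>Geodesics are identified with their images, so sides of triangles are point sets.\<close>

definition geodesic_segment ::
    "'a set \<Rightarrow> ('a \<Rightarrow> 'a \<Rightarrow> real) \<Rightarrow> 'a \<Rightarrow> 'a \<Rightarrow> 'a set \<Rightarrow> bool" where
  "geodesic_segment M d x y l \<longleftrightarrow>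
     (\<exists>g. is_geodesic M d g \<and> g 0 = x \<and> g 1 = y \<and> l = g ` {0..1})"

definition geodesic_space :: "'a set \<Rightarrow> ('a \<Rightarrow> 'a \<Rightarrow> real) \<Rightarrow> bool" where
  "geodesic_space M d \<longleftrightarrow> (\<forall>x\<in>M. \<forall>y\<in>M. \<exists>l. geodesic_segment M d x y l)"

text \<open>A triangle is carried around as its vertices together with its three sides
  \<open>[x,y]\<close>, \<open>[y,z]\<close>, \<open>[z,x]\<close>: perimeter and Rips condition refer to these rather than to
  the union of the sides alone. Degenerate triangles are allowed.\<close>

definition is_triangle ::
    "'a set \<Rightarrow> ('a \<Rightarrow> 'a \<Rightarrow> real) \<Rightarrow> 'a \<Rightarrow> 'a \<Rightarrow> 'a \<Rightarrow> 'a set \<Rightarrow> 'a set \<Rightarrow> 'a set \<Rightarrow> bool" where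
  "is_triangle M d x y z l1 l2 l3 \<longleftrightarrow>
     geodesic_segment M d x y l1 \<and> geodesic_segment M d y z l2 \<and> geodesic_segment M d z x l3"

definition perimeter :: "('a \<Rightarrow> 'a \<Rightarrow> real) \<Rightarrow> 'a \<Rightarrow> 'a \<Rightarrow> 'a \<Rightarrow> real" where
  "perimeter d x y z = d x y + d y z + d z x"

definition dist_to_set :: "('a \<Rightarrow> 'a \<Rightarrow> real) \<Rightarrow> 'a \<Rightarrow> 'a set \<Rightarrow> real" where
  "dist_to_set d p A = (INF q\<in>A. d p q)"

definition rips_condition ::
    "('a \<Rightarrow> 'a \<Rightarrow> real) \<Rightarrow> 'a set \<Rightarrow> 'a set \<Rightarrow> 'a set \<Rightarrow> real \<Rightarrow> bool" where
  "rips_condition d l1 l2 l3 \<delta> \<longleftrightarrow>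
     (\<forall>p\<in>l1. dist_to_set d p (l2 \<union> l3) \<le> \<delta>) \<and>
     (\<forall>p\<in>l2. dist_to_set d p (l3 \<union> l1) \<le> \<delta>) \<and>
     (\<forall>p\<in>l3. dist_to_set d p (l1 \<union> l2) \<le> \<delta>)"

definition hyperbolic_space :: "real \<Rightarrow> 'a set \<Rightarrow> ('a \<Rightarrow> 'a \<Rightarrow> real) \<Rightarrow> bool" where
  "hyperbolic_space \<delta> M d \<longleftrightarrow> geodesic_space M d \<and>
     (\<forall>x y z l1 l2 l3. is_triangle M d x y z l1 l2 l3 \<longrightarrow> rips_condition d l1 l2 l3 \<delta>)"

definition real_tree :: "'a set \<Rightarrow> ('a \<Rightarrow> 'a \<Rightarrow> real) \<Rightarrow> bool" where
  "real_tree M d \<longleftrightarrow> hyperbolic_space 0 M d"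

definition triangle_delta :: "('a \<Rightarrow> 'a \<Rightarrow> real) \<Rightarrow> 'a set \<Rightarrow> 'a set \<Rightarrow> 'a set \<Rightarrow> real" where
  "triangle_delta d l1 l2 l3 = Inf {\<delta>. rips_condition d l1 l2 l3 \<delta>}"

definition delta_ratios :: "'a set \<Rightarrow> ('a \<Rightarrow> 'a \<Rightarrow> real) \<Rightarrow> real set" where
  "delta_ratios M d =
     {triangle_delta d l1 l2 l3 / perimeter d x y z | x y z l1 l2 l3.
        is_triangle M d x y z l1 l2 l3 \<and> perimeter d x y z > 0}"

text \<open>\<open>Sup\<close> on the reals is unspecified on the empty set, hence the case distinction. It is also
  unspecified on unbounded sets, as is \<open>Inf\<close> on empty or unbounded ones; the lemmas below show
  that neither situation arises here.\<close>

definition sup_delta_ratio :: "'a set \<Rightarrow> ('a \<Rightarrow> 'a \<Rightarrow> real) \<Rightarrow> real" where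
  "sup_delta_ratio M d = (if delta_ratios M d = {} then 0 else Sup (delta_ratios M d))"

lemma geodesic_segment_dist_le:
  assumes "geodesic_segment M d x y l" "p \<in> l"
  shows "x \<in> l" "y \<in> l" "d p x \<le> d x y"
proof -
  obtain g k where g: "g 0 = x" "g 1 = y" "l = g ` {0..1}" "k \<ge> 0"
    and iso: "\<And>t s. t \<in> {0..1} \<Longrightarrow> s \<in> {0..1} \<Longrightarrow> d (g t) (g s) = k * \<bar>t - s\<bar>"
    using assms(1) unfolding geodesic_segment_def is_geodesic_def by blast
  obtain t where t: "t \<in> {0..1}" "p = g t" using assms(2) g(3) by blast
  show "x \<in> l" "y \<in> l" unfolding g(3) by (simp_all add: image_iff g(1,2)[symmetric]) force+
  have "d p x = k * t" "d x y = k" using iso[of t 0] iso[of 0 1] t g(1,2) by auto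
  then show "d p x \<le> d x y" using t(1) g(4) by (simp add: mult_left_le)
qed

lemma (in Metric_space) dist_to_set_le:
  assumes "q \<in> A" shows "dist_to_set d p A \<le> d p q"
  unfolding dist_to_set_def by (rule cINF_lower[OF bdd_belowI2[of _ 0] assms]) simp

lemma (in Metric_space) rips_condition_perimeter:
  assumes "is_triangle M d x y z l1 l2 l3"
  shows "rips_condition d l1 l2 l3 (perimeter d x y z)"
proof -
  have s: "geodesic_segment M d x y l1" "geodesic_segment M d y z l2" "geodesic_segment M d z x l3"
    using assms by (auto simp: is_triangle_def)
  have ends: "\<exists>p. p \<in> l" if "geodesic_segment M d u v l" for u v l
    using that unfolding geodesic_segment_def by force
  have "x \<in> l3" "y \<in> l1" "z \<in> l2"
    using ends[OF s(1)] ends[OF s(2)] ends[OF s(3)]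
      geodesic_segment_dist_le(2)[OF s(1)] geodesic_segment_dist_le(2)[OF s(2)]
      geodesic_segment_dist_le(2)[OF s(3)] by blast+
  moreover have "d p x \<le> perimeter d x y z" if "p \<in> l1" for p
    using geodesic_segment_dist_le(3)[OF s(1) that] nonneg[of y z] nonneg[of z x]
    unfolding perimeter_def by linarith
  moreover have "d p y \<le> perimeter d x y z" if "p \<in> l2" for p
    using geodesic_segment_dist_le(3)[OF s(2) that] nonneg[of x y] nonneg[of z x]
    unfolding perimeter_def by linarith
  moreover have "d p z \<le> perimeter d x y z" if "p \<in> l3" for p
    using geodesic_segment_dist_le(3)[OF s(3) that] nonneg[of y z] nonneg[of x y]
    unfolding perimeter_def by linarith
  ultimately show ?thesis
    unfolding rips_condition_def by (meson UnI1 UnI2 dist_to_set_le order_trans)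
qed

lemma (in Metric_space) rips_condition_nonneg:
  assumes "is_triangle M d x y z l1 l2 l3" "rips_condition d l1 l2 l3 \<delta>"
  shows "0 \<le> \<delta>"
proof -
  have "l1 \<noteq> {}" "l2 \<noteq> {}"
    using assms(1) by (auto simp: is_triangle_def geodesic_segment_def)
  then obtain p where "p \<in> l1" by blast
  have "0 \<le> dist_to_set d p (l2 \<union> l3)"
    unfolding dist_to_set_def using \<open>l2 \<noteq> {}\<close> by (intro cINF_greatest) auto
  then show ?thesis using assms(2) \<open>p \<in> l1\<close> unfolding rips_condition_def by force
qed

lemma (in Metric_space) rips_constants_nonempty_bdd_below:
  assumes "is_triangle M d x y z l1 l2 l3"
  shows "{\<delta>. rips_condition d l1 l2 l3 \<delta>} \<noteq> {}" "bdd_below {\<delta>. rips_condition d l1 l2 l3 \<delta>}"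
  using rips_condition_perimeter[OF assms] rips_condition_nonneg[OF assms]
  by (blast, intro bdd_belowI[of _ 0]) simp

lemma (in Metric_space) delta_ratios_bounds:
  assumes "r \<in> delta_ratios M d"
  shows "0 \<le> r" "r \<le> 1"
proof -
  obtain x y z l1 l2 l3 where t: "is_triangle M d x y z l1 l2 l3"
    and pos: "perimeter d x y z > 0"
    and r: "r = triangle_delta d l1 l2 l3 / perimeter d x y z"
    using assms unfolding delta_ratios_def by blast
  note ne = rips_constants_nonempty_bdd_below[OF t]
  have "0 \<le> triangle_delta d l1 l2 l3"
    unfolding triangle_delta_def using ne(1) rips_condition_nonneg[OF t]
    by (intro cInf_greatest) auto
  moreover have "triangle_delta d l1 l2 l3 \<le> perimeter d x y z"
    unfolding triangle_delta_def using rips_condition_perimeter[OF t]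
    by (intro cInf_lower ne(2)) simp
  ultimately show "0 \<le> r" "r \<le> 1" using pos r by simp_all
qed

lemma (in Metric_space) delta_ratios_bdd_above: "bdd_above (delta_ratios M d)"
  using delta_ratios_bounds(2) by (rule bdd_aboveI)

end

theory Submission
  imports Defs
begin

text \<open>Let \<open>\<epsilon>\<close> be the supremum of the ratios, so that in every triangle each point of a side lies
  within \<open>\<epsilon>\<close> times the perimeter of the other two sides (this is what \<open>relatively_slim \<epsilon>\<close> says).
  The point of the proof is that if \<open>\<epsilon> \<le> 1/32\<close>, then the same holds with \<open>7\<epsilon>/8\<close> in place of \<open>\<epsilon>\<close>
  (\<open>relatively_slim_improve\<close>). By minimality of the supremum \<open>\<epsilon> \<le> 7\<epsilon>/8\<close>, hence \<open>\<epsilon> = 0\<close> and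
  the space is a real tree. The converse is immediate, since all ratios vanish in a real tree.

  To improve the constant, take a triangle of perimeter \<open>P\<close> and put \<open>D = \<epsilon>P\<close>. The sides of the
  triangle issuing from a common vertex actually coincide outside a central part of size
  comparable to \<open>D\<close>. This rests on a bootstrap
  (\<open>halve_distance_to_geodesic\<close>): if two geodesics issue from the same point and the first stays
  within \<open>D\<close> of the second up to distance \<open>r\<close> from its endpoint, then it stays within \<open>D/2\<close> of it
  up to distance \<open>r + D\<close>, as one sees by cutting a quadrilateral of size comparable to \<open>D\<close> into
  two triangles. Iterating and summing a geometric series,
  two sides of a triangle of perimeter at most \<open>P\<close> that issue from the same vertex, and whose
  endpoints are \<open>s\<close> apart, agree up to distance \<open>s + 3D\<close> from the endpoint
  (\<open>geodesics_from_common_point_merge\<close>).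

  By the intermediate value theorem, each side contains a point \<open>w\<close> within \<open>D\<close> of both other
  sides (\<open>side_point_near_both_other_sides\<close>). Merging geodesics around \<open>w\<close> yields three points,
  each common to two sides, which span a central triangle of perimeter at most \<open>28D\<close>. A point of
  the side through \<open>w\<close> either belongs to another side, or lies on the central triangle and is
  therefore within \<open>\<epsilon> \<cdot> 28D \<le> (7/8) D\<close> of the other sides.\<close>

section \<open>Geodesic segments\<close>

context Metric_space
begin

text \<open>A geodesic on \<open>[0,1]\<close> with speed \<open>k\<close> is reparametrised by arc length on \<open>[0,k]\<close>; here
  \<open>k = d x y\<close>, and \<open>k = 0\<close> gives the constant curve.\<close>

lemma geodesic_segment_arclength:
  assumes "geodesic_segment M d x y l"
  obtains \<gamma> where "\<gamma> 0 = x" "\<gamma> (d x y) = y" "l = \<gamma> ` {0..d x y}" "l \<subseteq> M"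
    "\<And>s t. s \<in> {0..d x y} \<Longrightarrow> t \<in> {0..d x y} \<Longrightarrow> d (\<gamma> s) (\<gamma> t) = \<bar>s - t\<bar>"
proof -
  obtain g k where g: "g 0 = x" "g 1 = y" "l = g ` {0..1}" "k \<ge> 0" "g ` {0..1} \<subseteq> M"
    and iso: "\<And>t s. t \<in> {0..1} \<Longrightarrow> s \<in> {0..1} \<Longrightarrow> d (g t) (g s) = k * \<bar>t - s\<bar>"
    using assms unfolding geodesic_segment_def is_geodesic_def by blast
  have k: "k = d x y" using iso[of 0 1] g by simp
  show ?thesis
  proof (cases "k = 0")
    case True
    have "g t = x" if "t \<in> {0..1}" for t
    proof -
      have "d (g t) (g 0) = 0" using iso[of t 0] that True by simp
      moreover have "g t \<in> M" "g 0 \<in> M" using g(5) that by auto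
      ultimately show ?thesis using g(1) by simp
    qed
    then have const: "g ` {0..1} = {x}" "y = x" using g(2) by force+
    have len: "d x y = 0" using True k by simp
    show ?thesis
      by (rule that[of "\<lambda>_. x"]) (use const g(3,5) len in simp_all)
  next
    case False
    with g(4) have kp: "k > 0" by simp
    have im: "(\<lambda>t. t / k) ` {0..k} = {0..1}"
      using kp by (simp add: image_divide_atLeastAtMost)
    have "d (g (s/k)) (g (t/k)) = \<bar>s - t\<bar>" if "s \<in> {0..k}" "t \<in> {0..k}" for s t
    proof -
      have "d (g (s/k)) (g (t/k)) = k * \<bar>s/k - t/k\<bar>"
        using that kp by (intro iso) (auto simp: field_simps)
      also have "\<dots> = \<bar>s - t\<bar>"
        using kp by (simp add: diff_divide_distrib[symmetric])
      finally show ?thesis .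
    qed
    moreover have "l = (\<lambda>t. g (t / k)) ` {0..k}"
      using g(3) im by (metis image_image)
    ultimately show ?thesis
      using that[of "\<lambda>t. g (t / k)"] g k kp by auto
  qed
qed

lemma geodesic_segment_of_arclength:
  assumes "\<gamma> ` {a..b} \<subseteq> M" "a \<le> b"
    and iso: "\<And>s t. s \<in> {a..b} \<Longrightarrow> t \<in> {a..b} \<Longrightarrow> d (\<gamma> s) (\<gamma> t) = \<bar>s - t\<bar>"
  shows "geodesic_segment M d (\<gamma> a) (\<gamma> b) (\<gamma> ` {a..b})"
proof -
  define g where "g t = \<gamma> (a + (b - a) * t)" for t
  have in_ab: "a + (b - a) * t \<in> {a..b}" if "t \<in> {0..1}" for t
  proof -
    have "(b - a) * t \<le> (b - a) * 1" using that assms(2) by (intro mult_left_mono) auto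
    then show ?thesis using that assms(2) by simp
  qed
  have "(\<lambda>t. a + (b - a) * t) ` {0..1} = {a..b}"
    using image_affinity_atLeastAtMost[of "b - a" a 0 1] assms(2) by (simp add: add.commute)
  then have im: "g ` {0..1} = \<gamma> ` {a..b}"
    unfolding g_def by (metis image_image)
  have "d (g t) (g s) = (b - a) * \<bar>t - s\<bar>" if "t \<in> {0..1}" "s \<in> {0..1}" for t s
  proof -
    have "d (g t) (g s) = \<bar>(b - a) * (t - s)\<bar>"
      unfolding g_def by (subst iso[OF in_ab in_ab]) (use that in \<open>auto simp: algebra_simps\<close>)
    then show ?thesis using assms(2) by (simp add: abs_mult)
  qed
  then have "is_geodesic M d g"
    unfolding is_geodesic_def using im assms(1,2) by (intro conjI exI[of _ "b - a"]) auto
  moreover have "g 0 = \<gamma> a" "g 1 = \<gamma> b" by (simp_all add: g_def)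
  ultimately show ?thesis
    unfolding geodesic_segment_def using im by metis
qed

lemma geodesic_segment_reverse:
  assumes "geodesic_segment M d x y l"
  shows "geodesic_segment M d y x l"
proof -
  obtain \<gamma> where g: "\<gamma> 0 = x" "\<gamma> (d x y) = y" "l = \<gamma> ` {0..d x y}" "l \<subseteq> M"
    "\<And>s t. s \<in> {0..d x y} \<Longrightarrow> t \<in> {0..d x y} \<Longrightarrow> d (\<gamma> s) (\<gamma> t) = \<bar>s - t\<bar>"
    using geodesic_segment_arclength[OF assms] by blast
  have im: "(\<lambda>t. \<gamma> (- t)) ` {- d x y..0} = l"
    unfolding g(3) by (metis image_image image_uminus_atLeastAtMost minus_minus minus_zero)
  have "geodesic_segment M d (\<gamma> (- (- d x y))) (\<gamma> (- 0)) ((\<lambda>t. \<gamma> (- t)) ` {- d x y..0})"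
    by (rule geodesic_segment_of_arclength) (use im g(4,5) in auto)
  then show ?thesis using g im by simp
qed

lemma geodesic_segment_in_carrier:
  assumes "geodesic_segment M d x y l"
  shows "l \<subseteq> M" "x \<in> M" "y \<in> M" "x \<in> l" "y \<in> l"
proof -
  show "l \<subseteq> M"
    using assms unfolding geodesic_segment_def is_geodesic_def by blast
  moreover obtain p where "p \<in> l"
    using assms unfolding geodesic_segment_def by force
  then show "x \<in> l" "y \<in> l" using geodesic_segment_dist_le[OF assms] by auto
  ultimately show "x \<in> M" "y \<in> M" by auto
qed

lemma geodesic_segment_dist_add:
  assumes "geodesic_segment M d x y l" "p \<in> l"
  shows "d x p + d p y = d x y"
proof -
  obtain \<gamma> where g: "\<gamma> 0 = x" "\<gamma> (d x y) = y" "l = \<gamma> ` {0..d x y}"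
    "\<And>s t. s \<in> {0..d x y} \<Longrightarrow> t \<in> {0..d x y} \<Longrightarrow> d (\<gamma> s) (\<gamma> t) = \<bar>s - t\<bar>"
    using geodesic_segment_arclength[OF assms(1)] by metis
  obtain t where "t \<in> {0..d x y}" "p = \<gamma> t" using assms(2) g(3) by blast
  then show ?thesis using g(4)[of 0 t] g(4)[of t "d x y"] g(1,2) by auto
qed

lemma geodesic_segment_point_at:
  assumes "geodesic_segment M d x y l" "0 \<le> r" "r \<le> d x y"
  obtains p where "p \<in> l" "d x p = r"
proof -
  obtain \<gamma> where g: "\<gamma> 0 = x" "l = \<gamma> ` {0..d x y}"
    "\<And>s t. s \<in> {0..d x y} \<Longrightarrow> t \<in> {0..d x y} \<Longrightarrow> d (\<gamma> s) (\<gamma> t) = \<bar>s - t\<bar>"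
    using geodesic_segment_arclength[OF assms(1)] by metis
  show ?thesis using that[of "\<gamma> r"] g(3)[of 0 r] g(1,2) assms(2,3) by auto
qed

lemma geodesic_segment_between:
  assumes l: "geodesic_segment M d x y l" and "u \<in> l" "v \<in> l" "d x u \<le> d x v"
  obtains m where "geodesic_segment M d u v m" "m \<subseteq> l"
    "\<And>p. p \<in> l \<Longrightarrow> d x u \<le> d x p \<Longrightarrow> d x p \<le> d x v \<Longrightarrow> p \<in> m"
proof -
  obtain \<gamma> where g: "\<gamma> 0 = x" "l = \<gamma> ` {0..d x y}" "l \<subseteq> M" and
    iso: "\<And>s t. s \<in> {0..d x y} \<Longrightarrow> t \<in> {0..d x y} \<Longrightarrow> d (\<gamma> s) (\<gamma> t) = \<bar>s - t\<bar>"
    using geodesic_segment_arclength[OF l] by metis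
  have par: "p = \<gamma> (d x p)" "d x p \<in> {0..d x y}" if "p \<in> l" for p
  proof -
    obtain t where "t \<in> {0..d x y}" "p = \<gamma> t" using \<open>p \<in> l\<close> g(2) by blast
    then show "p = \<gamma> (d x p)" "d x p \<in> {0..d x y}" using iso[of 0 t] g(1) by auto
  qed
  have sub: "{d x u..d x v} \<subseteq> {0..d x y}" using par(2)[OF assms(3)] by auto
  let ?m = "\<gamma> ` {d x u..d x v}"
  have ml: "?m \<subseteq> l" unfolding g(2) by (rule image_mono[OF sub])
  have "geodesic_segment M d (\<gamma> (d x u)) (\<gamma> (d x v)) ?m"
    by (rule geodesic_segment_of_arclength) (use ml g(3) assms(4) iso sub in blast)+
  then show ?thesis
    using that[of ?m] ml par assms(2,3) by (metis atLeastAtMost_iff image_eqI)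
qed

lemma geodesic_segment_initial:
  assumes l: "geodesic_segment M d x y l" and "v \<in> l"
  obtains m where "geodesic_segment M d x v m" "m \<subseteq> l"
    "\<And>p. p \<in> l \<Longrightarrow> d x p \<le> d x v \<Longrightarrow> p \<in> m"
proof -
  have "d x x = 0" using geodesic_segment_in_carrier(2)[OF l] by simp
  then have "d x x \<le> d x p" for p by simp
  then show ?thesis
    using geodesic_segment_between[OF l geodesic_segment_in_carrier(4)[OF l] assms(2)] that by metis
qed

lemma geodesic_segment_dist_diff:
  assumes l: "geodesic_segment M d x y l" and "u \<in> l" "v \<in> l" "d x u \<le> d x v"
  shows "d u v = d x v - d x u"
proof -
  obtain m where m: "geodesic_segment M d x v m" "u \<in> m"
    using geodesic_segment_initial[OF l assms(3)] assms(2,4) by blast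
  show ?thesis using geodesic_segment_dist_add[OF m] by simp
qed

lemma geodesic_segment_sub:
  assumes l: "geodesic_segment M d x y l" and "u \<in> l" "v \<in> l"
  obtains m where "geodesic_segment M d u v m" "m \<subseteq> l"
proof (cases "d x u \<le> d x v")
  case True
  then show ?thesis using geodesic_segment_between[OF assms] that by blast
next
  case False
  then have "d x v \<le> d x u" by simp
  then obtain m where m: "geodesic_segment M d v u m" "m \<subseteq> l"
    using geodesic_segment_between[OF l assms(3,2)] by metis
  show ?thesis using that[OF geodesic_segment_reverse[OF m(1)] m(2)] .
qed

section \<open>Distance to a geodesic segment\<close>

lemma dist_to_set_triangle:
  assumes "p \<in> M" "q \<in> M" "A \<subseteq> M" "A \<noteq> {}"
  shows "dist_to_set d p A \<le> d p q + dist_to_set d q A"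
proof -
  have "dist_to_set d p A - d p q \<le> dist_to_set d q A"
    unfolding dist_to_set_def[of d q]
  proof (rule cINF_greatest[OF assms(4)])
    fix a assume "a \<in> A"
    then show "dist_to_set d p A - d p q \<le> d q a"
      using dist_to_set_le[of a A p] triangle[of p q a] assms by force
  qed
  then show ?thesis by simp
qed

lemma dist_to_set_lipschitz:
  assumes "p \<in> M" "q \<in> M" "A \<subseteq> M" "A \<noteq> {}"
  shows "\<bar>dist_to_set d p A - dist_to_set d q A\<bar> \<le> d p q"
  using dist_to_set_triangle[OF assms] dist_to_set_triangle[OF assms(2,1,3,4)] commute[of p q]
  by linarith

lemma continuous_on_arclength:
  fixes f :: "'a \<Rightarrow> real"
  assumes iso: "\<And>s t. s \<in> {0..L} \<Longrightarrow> t \<in> {0..L} \<Longrightarrow> d (\<gamma> s) (\<gamma> t) = \<bar>s - t\<bar>"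
    and "\<gamma> ` {0..L} \<subseteq> M"
    and f: "\<And>p q. p \<in> M \<Longrightarrow> q \<in> M \<Longrightarrow> \<bar>f p - f q\<bar> \<le> d p q"
  shows "continuous_on {0..L} (\<lambda>t. f (\<gamma> t))"
proof (rule continuous_onI)
  fix t e :: real assume t: "t \<in> {0..L}" "0 < e"
  have "dist (f (\<gamma> s)) (f (\<gamma> t)) \<le> e" if "s \<in> {0..L}" "dist s t < e" for s
    using f[of "\<gamma> s" "\<gamma> t"] iso[OF that(1) t(1)] that t assms(2)
    by (auto simp: dist_real_def image_subset_iff)
  then show "\<exists>r>0. \<forall>s\<in>{0..L}. dist s t < r \<longrightarrow> dist (f (\<gamma> s)) (f (\<gamma> t)) \<le> e"
    using t(2) by blast
qed

lemma dist_to_set_attained: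
  assumes l: "geodesic_segment M d x y l" and p: "p \<in> M"
  obtains q where "q \<in> l" "d p q = dist_to_set d p l"
proof -
  obtain \<gamma> where g: "\<gamma> 0 = x" "l = \<gamma> ` {0..d x y}" "l \<subseteq> M" and
    iso: "\<And>s t. s \<in> {0..d x y} \<Longrightarrow> t \<in> {0..d x y} \<Longrightarrow> d (\<gamma> s) (\<gamma> t) = \<bar>s - t\<bar>"
    using geodesic_segment_arclength[OF l] by metis
  have "continuous_on {0..d x y} (\<lambda>t. d p (\<gamma> t))"
  proof (rule continuous_on_arclength[OF iso])
    show "\<bar>d p u - d p v\<bar> \<le> d u v" if "u \<in> M" "v \<in> M" for u v
      using triangle[of p u v] triangle[of p v u] commute[of u v] p that by linarith
  qed (use g in auto)
  then obtain t where t: "t \<in> {0..d x y}" "\<And>s. s \<in> {0..d x y} \<Longrightarrow> d p (\<gamma> t) \<le> d p (\<gamma> s)"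
    using continuous_attains_inf[of "{0..d x y}" "\<lambda>t. d p (\<gamma> t)"] by auto
  have "d p (\<gamma> t) \<le> dist_to_set d p l"
    unfolding dist_to_set_def g(2) using t by (intro cINF_greatest) auto
  then show ?thesis
    using that[of "\<gamma> t"] dist_to_set_le[of "\<gamma> t" l p] t(1) g(2) by fastforce
qed

lemma dist_to_set_Un_attained:
  assumes "geodesic_segment M d x y l" "geodesic_segment M d x' y' l'" "p \<in> M"
    "dist_to_set d p (l \<union> l') \<le> r"
  obtains q where "q \<in> l \<union> l'" "d p q \<le> r"
proof -
  obtain q where q: "q \<in> l" "d p q = dist_to_set d p l"
    using dist_to_set_attained assms(1,3) by blast
  obtain q' where q': "q' \<in> l'" "d p q' = dist_to_set d p l'"
    using dist_to_set_attained assms(2,3) by blast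
  have "min (d p q) (d p q') \<le> d p a" if "a \<in> l \<union> l'" for a
    using that dist_to_set_le[of a l p] dist_to_set_le[of a l' p] q q' by auto
  then have "min (d p q) (d p q') \<le> dist_to_set d p (l \<union> l')"
    unfolding dist_to_set_def using q(1) by (intro cINF_greatest) auto
  then show ?thesis using that q q' assms(4) by (metis UnI1 UnI2 min_le_iff_disj order_trans)
qed

end

section \<open>Geodesics issuing from a common point\<close>

text \<open>A scale-invariant Rips condition: the slimness constant of a triangle is at most \<open>\<epsilon>\<close> times its
  perimeter. It suffices to require this for the side joining the first two vertices, because the
  vertices of a triangle may be permuted cyclically. The nearby point is required to exist, which
  is equivalent to a bound on the infimum of distances because sides are compact.\<close>

definition relatively_slim :: "real \<Rightarrow> 'a set \<Rightarrow> ('a \<Rightarrow> 'a \<Rightarrow> real) \<Rightarrow> bool" where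
  "relatively_slim \<epsilon> M d \<longleftrightarrow>
     (\<forall>x y z l1 l2 l3. is_triangle M d x y z l1 l2 l3 \<longrightarrow>
        (\<forall>p\<in>l1. \<exists>q\<in>l2 \<union> l3. d p q \<le> \<epsilon> * perimeter d x y z))"

context Metric_space
begin

lemma relatively_slimD:
  assumes "relatively_slim \<epsilon> M d" "geodesic_segment M d x y l1" "geodesic_segment M d y z l2"
    "geodesic_segment M d z x l3" "p \<in> l1"
  obtains q where "q \<in> l2 \<union> l3" "d p q \<le> \<epsilon> * (d x y + d y z + d z x)"
  using assms unfolding relatively_slim_def is_triangle_def perimeter_def by blast

text \<open>The bootstrap step. Around \<open>p\<close> one takes \<open>x1\<close> at distance \<open>3D/2\<close> towards the common point
  \<open>x\<close> (or \<open>x1 = x\<close> if that is nearer) and \<open>y1\<close> at distance \<open>D\<close> towards \<open>y\<close>, with points \<open>x2\<close>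
  and \<open>y2\<close> of the other geodesic within \<open>D\<close> of them. The diagonal from \<open>y2\<close> to \<open>x1\<close> divides the
  quadrilateral into triangles of perimeter at most \<open>7D\<close> and \<open>9D\<close>. Passing through them, \<open>p\<close>
  comes within \<open>(7D + 9D)/32 = D/2\<close> of the remaining sides. The sides \<open>[x1,x2]\<close> and \<open>[y1,y2]\<close>
  are too far from \<open>p\<close> to be of any help, except through their endpoints on the other geodesic.\<close>

lemma halve_distance_to_geodesic:
  assumes geo: "geodesic_space M d" and slim: "relatively_slim \<epsilon> M d"
    and eps: "0 \<le> \<epsilon>" "\<epsilon> \<le> 1/32"
    and l: "geodesic_segment M d x y l" and l': "geodesic_segment M d x z l'"
    and D: "0 \<le> D"
    and near: "\<And>p. p \<in> l \<Longrightarrow> r \<le> d p y \<Longrightarrow> \<exists>q\<in>l'. d p q \<le> D"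
    and p: "p \<in> l" "r + D \<le> d p y" "D \<le> d p y"
  shows "\<exists>q\<in>l'. d p q \<le> D / 2"
proof -
  note in_l = geodesic_segment_in_carrier[OF l] and in_l' = geodesic_segment_in_carrier[OF l']
  have pM: "p \<in> M" using p(1) in_l by auto
  have eps_le: "\<epsilon> * c \<le> b / 32" if "0 \<le> c" "c \<le> b" for b c
    using mult_mono[OF eps(2) that(2)] eps that by simp
  have addp: "d x p + d p y = d x y" using geodesic_segment_dist_add[OF l p(1)] .
  define A where "A = min (3 / 2 * D) (d x p)"
  have A: "0 \<le> A" "A \<le> 3 / 2 * D" "A \<le> d x p" using D by (auto simp: A_def)
  obtain x1 where x1: "x1 \<in> l" "d x x1 = d x p - A"
  proof (rule geodesic_segment_point_at[OF l])
    show "0 \<le> d x p - A" "d x p - A \<le> d x y" using A addp nonneg[of p y] by linarith+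
  qed
  obtain y1 where y1: "y1 \<in> l" "d x y1 = d x p + D"
  proof (rule geodesic_segment_point_at[OF l])
    show "0 \<le> d x p + D" "d x p + D \<le> d x y" using D addp p(3) nonneg[of x p] by linarith+
  qed
  obtain m where m: "geodesic_segment M d x1 y1 m" "m \<subseteq> l" "p \<in> m"
  proof -
    have "d x x1 \<le> d x y1" "d x x1 \<le> d x p" "d x p \<le> d x y1"
      using x1(2) y1(2) A D by linarith+
    then show ?thesis using geodesic_segment_between[OF l x1(1) y1(1)] p(1) that by metis
  qed
  have M1: "x1 \<in> M" "y1 \<in> M" using x1 y1 in_l by auto
  have dx1p: "d x1 p = A" using geodesic_segment_dist_diff[OF l x1(1) p(1)] x1(2) A by simp
  have dpy1: "d p y1 = D" using geodesic_segment_dist_diff[OF l p(1) y1(1)] y1(2) D by simp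
  have dxy1: "d x1 y1 = A + D" using geodesic_segment_dist_add[OF m(1,3)] dx1p dpy1 by simp
  have "d x y1 + d y1 y = d x y" "d x x1 + d x1 y = d x y"
    using geodesic_segment_dist_add[OF l x1(1)] geodesic_segment_dist_add[OF l y1(1)] by simp_all
  then have r1: "r \<le> d y1 y" "r \<le> d x1 y" using x1(2) y1(2) addp p(2) A D by linarith+
  obtain y2 where y2: "y2 \<in> l'" "d y1 y2 \<le> D" using near[OF y1(1) r1(1)] by blast
  obtain x2 where x2: "x2 \<in> l'" "d x1 x2 \<le> D" "x1 = x \<Longrightarrow> x2 = x"
  proof (cases "x1 = x")
    case True
    then show ?thesis using that[of x] in_l' D by simp
  next
    case False
    then show ?thesis using near[OF x1(1) r1(2)] that by blast
  qed
  have M2: "x2 \<in> M" "y2 \<in> M" using x2 y2 in_l' by auto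
  obtain b where b: "geodesic_segment M d y1 y2 b"
    using geo M1 M2 unfolding geodesic_space_def by blast
  obtain c where c: "geodesic_segment M d y2 x1 c"
    using geo M1 M2 unfolding geodesic_space_def by blast
  obtain a where a: "geodesic_segment M d x1 x2 a"
    using geo M1 M2 unfolding geodesic_space_def by blast
  obtain e where e: "geodesic_segment M d x2 y2 e" "e \<subseteq> l'"
    using geodesic_segment_sub[OF l' x2(1) y2(1)] .
  have dy2x1: "d y2 x1 \<le> A + 2 * D"
    using triangle[OF M2(2) M1(2,1)] commute[of y1 y2] commute[of y1 x1] dxy1 y2(2) by linarith
  have dx2y2: "d x2 y2 \<le> A + 3 * D"
    using triangle[OF M2(1) M1(1) M2(2)] commute[of x1 x2] commute[of y2 x1] dy2x1 x2(2)
    by linarith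
  obtain q1 where q1: "q1 \<in> b \<union> c" "d p q1 \<le> \<epsilon> * (d x1 y1 + d y1 y2 + d y2 x1)"
    using relatively_slimD[OF slim m(1) b c m(3)] .
  have q1': "d p q1 \<le> (7 * D) / 32"
    by (rule order_trans[OF q1(2)], rule eps_le)
      (use nonneg dxy1 y2(2) dy2x1 A in \<open>auto intro!: add_nonneg_nonneg\<close>)
  have q1M: "q1 \<in> M"
    using q1(1) geodesic_segment_in_carrier(1)[OF b] geodesic_segment_in_carrier(1)[OF c] by blast
  show ?thesis
  proof (cases "q1 \<in> b")
    case True
    have "d y1 q1 + d q1 y2 = d y1 y2" using geodesic_segment_dist_add[OF b True] .
    moreover have "D \<le> d p q1 + d y1 q1"
      using triangle[OF pM q1M M1(2)] dpy1 commute[of q1 y1] by linarith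
    moreover have "d p y2 \<le> d p q1 + d q1 y2" using triangle[OF pM q1M M2(2)] .
    ultimately have "d p y2 \<le> D / 2" using q1' y2(2) D by linarith
    then show ?thesis using y2(1) by blast
  next
    case False
    then have "q1 \<in> c" using q1(1) by blast
    then obtain q2 where q2: "q2 \<in> a \<union> e" "d q1 q2 \<le> \<epsilon> * (d y2 x1 + d x1 x2 + d x2 y2)"
      using relatively_slimD[OF slim c a e(1)] by blast
    have q2': "d q1 q2 \<le> (9 * D) / 32"
      by (rule order_trans[OF q2(2)], rule eps_le)
        (use nonneg x2(2) dx2y2 dy2x1 A in \<open>auto intro!: add_nonneg_nonneg\<close>)
    have q2M: "q2 \<in> M"
      using q2(1) geodesic_segment_in_carrier(1)[OF a] geodesic_segment_in_carrier(1)[OF e(1)]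
      by blast
    have pq2: "d p q2 \<le> D / 2"
      using triangle[OF pM q1M q2M] q1' q2' by linarith
    show ?thesis
    proof (cases "q2 \<in> e")
      case True
      then show ?thesis using e(2) pq2 by blast
    next
      case False
      then have add: "d x1 q2 + d q2 x2 = d x1 x2"
        using q2(1) geodesic_segment_dist_add[OF a] by blast
      show ?thesis
      proof (cases "x1 = x")
        case True
        then have "d x1 q2 = 0"
          using add x2(3) M1(1) nonneg[of x1 q2] nonneg[of q2 x2] by (smt (verit) mdist_zero)
        then have "q2 = x" using True M1(1) q2M by simp
        then show ?thesis using pq2 in_l' by blast
      next
        case False
        then have "d x x1 \<noteq> 0" using M1(1) in_l by simp
        then have "A = 3 / 2 * D" using x1(2) by (auto simp: A_def min_def split: if_splits)
        then have "D \<le> d x1 q2"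
          using triangle[OF M1(1) q2M pM] dx1p commute[of q2 p] pq2 by linarith
        then have "d q2 x2 = 0" using add x2(2) nonneg[of q2 x2] by linarith
        then have "q2 = x2" using q2M M2 by simp
        then show ?thesis using pq2 x2(1) by blast
      qed
    qed
  qed
qed

text \<open>The distance bounds \<open>D, D/2, D/4, \<dots>\<close> are valid up to distances \<open>s + D\<close>, \<open>s + 2D\<close>,
  \<open>s + 5D/2\<close>, \<open>\<dots>\<close> from the endpoint \<open>y\<close>, and these increase to \<open>s + 3D\<close>.\<close>

lemma geodesics_from_common_point_merge:
  assumes geo: "geodesic_space M d" and slim: "relatively_slim \<epsilon> M d"
    and eps: "0 \<le> \<epsilon>" "\<epsilon> \<le> 1/32"
    and l: "geodesic_segment M d x y l" and l': "geodesic_segment M d x z l'"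
    and s: "d y z \<le> s" and D: "\<epsilon> * (d x y + d y z + d z x) \<le> D"
    and p: "p \<in> l" "s + 3 * D \<le> d p y"
  shows "p \<in> l'"
proof -
  note in_l = geodesic_segment_in_carrier[OF l] and in_l' = geodesic_segment_in_carrier[OF l']
  have D0: "0 \<le> D"
    using D eps nonneg by (meson add_nonneg_nonneg mult_nonneg_nonneg order_trans)
  have s0: "0 \<le> s" using s nonneg[of y z] by linarith
  have close: "\<exists>q\<in>l'. d p q \<le> D / 2 ^ n"
    if "p \<in> l" "s + 3 * D - 2 * D / 2 ^ n \<le> d p y" for n p
    using that
  proof (induction n arbitrary: p)
    case 0
    \<comment> \<open>A point of \<open>[y,z]\<close> within \<open>D\<close> of \<open>p\<close> is at distance at least \<open>s \<ge> d(y,z)\<close> from \<open>y\<close>,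
      so it can only be \<open>z\<close>.\<close>
    obtain b where b: "geodesic_segment M d y z b"
      using geo in_l in_l' unfolding geodesic_space_def by blast
    obtain q where q: "q \<in> b \<union> l'" "d p q \<le> \<epsilon> * (d x y + d y z + d z x)"
      using relatively_slimD[OF slim l b geodesic_segment_reverse[OF l'] 0(1)] .
    show ?case
    proof (cases "q \<in> l'")
      case True
      then show ?thesis using q(2) D by force
    next
      case False
      then have qb: "q \<in> b" using q(1) by blast
      then have qM: "q \<in> M" using geodesic_segment_in_carrier[OF b] by blast
      have "d p y \<le> d p q + d y q"
        using triangle[of p q y] 0(1) in_l qM commute[of q y] by auto
      then have "s \<le> d y q" using 0(2) q(2) D by simp
      then have "d q z = 0"
        using geodesic_segment_dist_add[OF b qb] s nonneg[of q z] by linarith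
      then have "q = z" using qM in_l' by simp
      then show ?thesis using q(2) D in_l' by force
    qed
  next
    case (Suc n)
    define E where "E = D / 2 ^ n"
    have E: "0 \<le> E" "E \<le> D" "D / 2 ^ Suc n = E / 2"
      using D0 by (simp_all add: E_def divide_le_eq mult_le_cancel_left1)
    have far: "s + 3 * D - E \<le> d p y" using Suc.prems(2) by (simp add: E_def)
    have "\<exists>q\<in>l'. d p q \<le> E / 2"
    proof (rule halve_distance_to_geodesic[OF geo slim eps l l' E(1) _ Suc.prems(1)])
      show "\<exists>q\<in>l'. d p q \<le> E" if "p \<in> l" "s + 3 * D - 2 * E \<le> d p y" for p
        using Suc.IH[OF that(1)] that(2) by (simp add: E_def)
      show "s + 3 * D - 2 * E + E \<le> d p y" "E \<le> d p y"
        using far s0 D0 E(1,2) by linarith+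
    qed
    then show ?case unfolding E(3) .
  qed
  have pM: "p \<in> M" using p in_l by blast
  obtain q where q: "q \<in> l'" "d p q = dist_to_set d p l'"
    using dist_to_set_attained[OF l' pM] .
  have "d p q \<le> D / 2 ^ n" for n
  proof -
    have "0 \<le> 2 * D / 2 ^ n" using D0 by simp
    then have "s + 3 * D - 2 * D / 2 ^ n \<le> d p y" using p(2) by linarith
    then obtain a where "a \<in> l'" "d p a \<le> D / 2 ^ n" using close[OF p(1)] by blast
    then show ?thesis using q(2) dist_to_set_le[of a l' p] by linarith
  qed
  moreover have "(\<lambda>n. D / 2 ^ n) \<longlonglongrightarrow> 0"
    using LIMSEQ_divide_realpow_zero[of 2 D] by simp
  ultimately have "d p q \<le> 0" by (meson LIMSEQ_le_const)
  then have "p = q" using nonneg[of p q] pM q(1) in_l' by (metis antisym subsetD zero)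
  then show ?thesis using q by simp
qed

section \<open>The central triangle\<close>

text \<open>The difference of the distances to the two other sides changes sign along the side, and where
  both distances agree they equal the distance to the union.\<close>

lemma side_point_near_both_other_sides:
  assumes slim: "relatively_slim \<epsilon> M d"
    and l1: "geodesic_segment M d x y l1" and l2: "geodesic_segment M d y z l2"
    and l3: "geodesic_segment M d z x l3"
  obtains w w1 w2 where "w \<in> l1" "w1 \<in> l3" "w2 \<in> l2"
    "d w w1 \<le> \<epsilon> * perimeter d x y z" "d w w2 \<le> \<epsilon> * perimeter d x y z"
proof -
  note in_l2 = geodesic_segment_in_carrier[OF l2] and in_l3 = geodesic_segment_in_carrier[OF l3]
  obtain \<gamma> where g: "\<gamma> 0 = x" "\<gamma> (d x y) = y" "l1 = \<gamma> ` {0..d x y}" "l1 \<subseteq> M" and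
    iso: "\<And>s t. s \<in> {0..d x y} \<Longrightarrow> t \<in> {0..d x y} \<Longrightarrow> d (\<gamma> s) (\<gamma> t) = \<bar>s - t\<bar>"
    using geodesic_segment_arclength[OF l1] by metis
  define f where "f A t = dist_to_set d (\<gamma> t) A" for A t
  have cont: "continuous_on {0..d x y} (f A)" if "A \<subseteq> M" "A \<noteq> {}" for A
    unfolding f_def using dist_to_set_lipschitz that g(3,4)
    by (intro continuous_on_arclength[OF iso]) auto
  have nn: "0 \<le> f A t" if "A \<noteq> {}" for A t
    unfolding f_def dist_to_set_def using that by (intro cINF_greatest) auto
  have ne: "l2 \<noteq> {}" "l3 \<noteq> {}" using in_l2 in_l3 by auto
  have "f l3 0 = 0" "f l2 (d x y) = 0"
    using nn[OF ne(2), of 0] nn[OF ne(1), of "d x y"] dist_to_set_le[of x l3 x]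
      dist_to_set_le[of y l2 y] in_l2 in_l3 g unfolding f_def by (simp_all add: antisym)
  then have "\<exists>t\<ge>0. t \<le> d x y \<and> f l3 t - f l2 t = 0"
    using nn[OF ne(1), of 0] nn[OF ne(2), of "d x y"] cont[OF in_l2(1) ne(1)] cont[OF in_l3(1) ne(2)]
    by (intro IVT') (auto intro: continuous_on_diff)
  then obtain t where t: "t \<in> {0..d x y}" "f l3 t = f l2 t" by auto
  have w: "\<gamma> t \<in> l1" "\<gamma> t \<in> M" using t(1) g by auto
  obtain q where q: "q \<in> l2 \<union> l3" "d (\<gamma> t) q \<le> \<epsilon> * perimeter d x y z"
    using relatively_slimD[OF slim l1 l2 l3 w(1)] unfolding perimeter_def .
  obtain w1 where w1: "w1 \<in> l3" "d (\<gamma> t) w1 = f l3 t"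
    using dist_to_set_attained[OF l3 w(2)] unfolding f_def .
  obtain w2 where w2: "w2 \<in> l2" "d (\<gamma> t) w2 = f l2 t"
    using dist_to_set_attained[OF l2 w(2)] unfolding f_def .
  have "f l3 t \<le> d (\<gamma> t) q"
    using q(1) dist_to_set_le[of q l2 "\<gamma> t"] dist_to_set_le[of q l3 "\<gamma> t"] t(2)
    unfolding f_def by auto
  then show ?thesis using that[OF w(1) w1(1) w2(1)] w1(2) w2(2) q(2) t(2) by simp
qed

text \<open>If the first geodesic is shorter than \<open>s + 3D\<close>, the common starting point \<open>x\<close> serves as the
  common point \<open>c\<close>; otherwise \<open>c\<close> is the point at distance \<open>s + 3D\<close> from \<open>y\<close>.\<close>

lemma geodesics_common_point:
  assumes geo: "geodesic_space M d" and slim: "relatively_slim \<epsilon> M d"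
    and eps: "0 \<le> \<epsilon>" "\<epsilon> \<le> 1/32"
    and l: "geodesic_segment M d x y l" and l': "geodesic_segment M d x z l'"
    and s: "d y z \<le> s" and D: "\<epsilon> * (d x y + d y z + d z x) \<le> D"
  obtains c where "c \<in> l" "c \<in> l'" "d y c \<le> s + 3 * D"
    "\<And>p. p \<in> l \<Longrightarrow> d y c < d y p \<Longrightarrow> p \<in> l'"
proof -
  note in_l = geodesic_segment_in_carrier[OF l] and in_l' = geodesic_segment_in_carrier[OF l']
  have nn: "0 \<le> s + 3 * D"
    using D eps nonneg s
    by (smt (verit) mult_nonneg_nonneg)
  show ?thesis
  proof (cases "s + 3 * D \<le> d y x")
    case True
    obtain c where c: "c \<in> l" "d y c = s + 3 * D"
      using geodesic_segment_point_at[OF geodesic_segment_reverse[OF l] nn True] .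
    have "p \<in> l'" if "p \<in> l" "s + 3 * D \<le> d y p" for p
      using geodesics_from_common_point_merge[OF geo slim eps l l' s D that(1)] that(2)
      by (simp add: commute)
    then show ?thesis using that[of c] c by simp
  next
    case False
    have "d y p \<le> d y x" if "p \<in> l" for p
      using geodesic_segment_dist_add[OF l that] commute[of y p] commute[of y x] nonneg[of x p]
      by linarith
    then show ?thesis using that[of x] False in_l in_l' by force
  qed
qed

lemma relatively_slim_improve:
  assumes geo: "geodesic_space M d" and slim: "relatively_slim \<epsilon> M d"
    and eps: "0 \<le> \<epsilon>" "\<epsilon> \<le> 1/32"
  shows "relatively_slim (7 / 8 * \<epsilon>) M d"
  unfolding relatively_slim_def is_triangle_def
proof (intro allI impI ballI, elim conjE)
  fix x y z l1 l2 l3 p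
  assume l1: "geodesic_segment M d x y l1" and l2: "geodesic_segment M d y z l2"
    and l3: "geodesic_segment M d z x l3" and p: "p \<in> l1"
  note in_l1 = geodesic_segment_in_carrier[OF l1] and in_l2 = geodesic_segment_in_carrier[OF l2]
    and in_l3 = geodesic_segment_in_carrier[OF l3]
  define D where "D = \<epsilon> * perimeter d x y z"
  have D0: "0 \<le> D" unfolding D_def perimeter_def using eps by simp
  obtain w w1 w2 where w: "w \<in> l1" "w1 \<in> l3" "w2 \<in> l2" "d w w1 \<le> D" "d w w2 \<le> D"
    using side_point_near_both_other_sides[OF slim l1 l2 l3] unfolding D_def .
  have wM: "w \<in> M" "w1 \<in> M" "w2 \<in> M" using w in_l1 in_l2 in_l3 by auto
  have w12: "d w1 w2 \<le> 2 * D" using triangle[OF wM(2,1,3)] w commute[of w w1] by linarith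
  have split: "d x w + d w y = d x y" "d y w2 + d w2 z = d y z" "d z w1 + d w1 x = d z x"
    using geodesic_segment_dist_add[OF l1 w(1)] geodesic_segment_dist_add[OF l2 w(3)]
      geodesic_segment_dist_add[OF l3 w(2)] by simp_all
  have scale: "\<epsilon> * c \<le> D" if "c \<le> d x y + d y z + d z x" for c
    unfolding D_def perimeter_def using that eps by (intro mult_left_mono) auto
  note vM = in_l1(2,3) in_l2(3)
  obtain wx where wx: "geodesic_segment M d x w wx" "wx \<subseteq> l1"
      "\<And>p. p \<in> l1 \<Longrightarrow> d x p \<le> d x w \<Longrightarrow> p \<in> wx"
    using geodesic_segment_initial[OF l1 w(1)] by blast
  obtain wy where wy: "geodesic_segment M d y w wy" "wy \<subseteq> l1"
      "\<And>p. p \<in> l1 \<Longrightarrow> d y p \<le> d y w \<Longrightarrow> p \<in> wy"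
    using geodesic_segment_initial[OF geodesic_segment_reverse[OF l1] w(1)] by blast
  obtain w1x where w1x: "geodesic_segment M d x w1 w1x" "w1x \<subseteq> l3"
    using geodesic_segment_sub[OF l3 in_l3(5) w(2)] .
  obtain w1z where w1z: "geodesic_segment M d z w1 w1z" "w1z \<subseteq> l3"
    using geodesic_segment_sub[OF l3 in_l3(4) w(2)] .
  obtain w2y where w2y: "geodesic_segment M d y w2 w2y" "w2y \<subseteq> l2"
    using geodesic_segment_sub[OF l2 in_l2(4) w(3)] .
  obtain w2z where w2z: "geodesic_segment M d z w2 w2z" "w2z \<subseteq> l2"
    using geodesic_segment_sub[OF l2 in_l2(5) w(3)] .
  \<comment> \<open>The triangles \<open>(x,w,w1)\<close>, \<open>(y,w,w2)\<close> and \<open>(z,w1,w2)\<close> are inscribed in the given one, so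
    their perimeters do not exceed its perimeter.\<close>
  have px: "\<epsilon> * (d x w + d w w1 + d w1 x) \<le> D"
  proof (rule scale)
    show "d x w + d w w1 + d w1 x \<le> d x y + d y z + d z x"
      using triangle[OF wM(1) vM(2) wM(2)] triangle[OF vM(2,3) wM(2)] split by linarith
  qed
  have py: "\<epsilon> * (d y w + d w w2 + d w2 y) \<le> D"
  proof (rule scale)
    show "d y w + d w w2 + d w2 y \<le> d x y + d y z + d z x"
      using triangle[OF wM(1) vM(1) wM(3)] triangle[OF vM(1,3) wM(3)] split
        commute[of w y] commute[of w x] commute[of x z] commute[of z w2] commute[of w2 y]
      by linarith
  qed
  have pz: "\<epsilon> * (d z w1 + d w1 w2 + d w2 z) \<le> D"
  proof (rule scale)
    show "d z w1 + d w1 w2 + d w2 z \<le> d x y + d y z + d z x"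
      using triangle[OF wM(2) vM(1) wM(3)] triangle[OF vM(1,2) wM(3)] split by linarith
  qed
  \<comment> \<open>The constants are \<open>4D = s + 3D\<close> with \<open>s = D\<close>, and \<open>5D = s + 3D\<close> with \<open>s = 2D\<close>.\<close>
  obtain cx where cx: "cx \<in> wx" "cx \<in> w1x" "d w cx \<le> 4 * D"
      "\<And>p. p \<in> wx \<Longrightarrow> d w cx < d w p \<Longrightarrow> p \<in> w1x"
    using geodesics_common_point[OF geo slim eps wx(1) w1x(1) w(4) px] by auto
  obtain cy where cy: "cy \<in> wy" "cy \<in> w2y" "d w cy \<le> 4 * D"
      "\<And>p. p \<in> wy \<Longrightarrow> d w cy < d w p \<Longrightarrow> p \<in> w2y"
    using geodesics_common_point[OF geo slim eps wy(1) w2y(1) w(5) py] by auto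
  obtain cz where cz: "cz \<in> w1z" "cz \<in> w2z" "d w1 cz \<le> 5 * D"
    using geodesics_common_point[OF geo slim eps w1z(1) w2z(1) w12 pz] by auto
  have cM: "cx \<in> M" "cy \<in> M" "cz \<in> M"
    using cx(1) cy(1) cz(1) wx(2) wy(2) w1z(2) in_l1(1) in_l3(1) by blast+
  have cxw: "d x cx + d cx w = d x w" using geodesic_segment_dist_add[OF wx(1) cx(1)] .
  have cyw: "d y cy + d cy w = d y w" using geodesic_segment_dist_add[OF wy(1) cy(1)] .
  have cyx: "d x cy + d cy y = d x y"
    using geodesic_segment_dist_add[OF l1] cy(1) wy(2) by blast
  have px': "d x p + d p y = d x y" using geodesic_segment_dist_add[OF l1 p] .
  have order: "d x cx \<le> d x w" "d x w \<le> d x cy"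
    using cxw cyw cyx split(1) nonneg[of cx w] nonneg[of cy w] commute[of y w] commute[of y cy]
    by linarith+
  consider "p \<in> l3" | "p \<in> l2" | "d x cx \<le> d x p" "d x p \<le> d x cy"
  proof (cases "d x p < d x cx")
    case True
    then have pwx: "p \<in> wx" using wx(3)[OF p] order by simp
    have "d x p + d p w = d x w" using geodesic_segment_dist_add[OF wx(1) pwx] .
    then have "d w cx < d w p" using True cxw commute[of p w] commute[of cx w] by linarith
    then show ?thesis using that(1) cx(4)[OF pwx] w1x(2) by blast
  next
    case False
    show ?thesis
    proof (cases "d x cy < d x p")
      case True
      have "d y p \<le> d y w"
        using True order px' split(1) commute[of p y] commute[of w y] by linarith
      then have pwy: "p \<in> wy" using wy(3)[OF p] by simp
      have "d y p + d p w = d y w" using geodesic_segment_dist_add[OF wy(1) pwy] .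
      then have "d w cy < d w p"
        using True cyw cyx px' commute[of p w] commute[of cy w] commute[of p y] commute[of cy y]
        by linarith
      then show ?thesis using that(2) cy(4)[OF pwy] w2y(2) by blast
    next
      case False
      then show ?thesis using that(3) \<open>\<not> d x p < d x cx\<close> by simp
    qed
  qed
  then show "\<exists>q\<in>l2 \<union> l3. d p q \<le> 7 / 8 * \<epsilon> * perimeter d x y z"
  proof cases
    case 3
    obtain m1 where m1: "geodesic_segment M d cx cy m1" "p \<in> m1"
      using geodesic_segment_between[OF l1, of cx cy] cx(1) cy(1) wx(2) wy(2) order p 3
      by (metis order_trans subsetD)
    obtain m2 where m2: "geodesic_segment M d cy cz m2" "m2 \<subseteq> l2"
      using geodesic_segment_sub[OF l2, of cy cz] cy(2) cz(2) w2y(2) w2z(2) by blast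
    obtain m3 where m3: "geodesic_segment M d cz cx m3" "m3 \<subseteq> l3"
      using geodesic_segment_sub[OF l3, of cz cx] cx(2) cz(1) w1x(2) w1z(2) by blast
    obtain q where q: "q \<in> m2 \<union> m3" "d p q \<le> \<epsilon> * (d cx cy + d cy cz + d cz cx)"
      using relatively_slimD[OF slim m1(1) m2(1) m3(1) m1(2)] .
    \<comment> \<open>The sides of the central triangle have length at most
      \<open>4D + 4D\<close>, \<open>4D + 6D\<close> and \<open>6D + 4D\<close>.\<close>
    have "d w cz \<le> 6 * D" using triangle[OF wM(1,2) cM(3)] w(4) cz(3) by linarith
    then have per: "d cx cy + d cy cz + d cz cx \<le> 28 * D"
      using triangle[OF cM(1) wM(1) cM(2)] triangle[OF cM(2) wM(1) cM(3)]
        triangle[OF cM(3) wM(1) cM(1)] cx(3) cy(3)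
        commute[of w cx] commute[of w cy] commute[of w cz] by linarith
    note q(2)
    also have "\<epsilon> * (d cx cy + d cy cz + d cz cx) \<le> 1 / 32 * (28 * D)"
      using per eps by (intro mult_mono) auto
    also have "\<dots> = 7 / 8 * \<epsilon> * perimeter d x y z" by (simp add: D_def)
    finally show ?thesis using q(1) m2(2) m3(2) by blast
  qed (use D0 p in_l1 in \<open>auto simp: D_def intro!: bexI[of _ p]\<close>)
qed

section \<open>Ratios\<close>

lemma triangle_delta_least:
  assumes "is_triangle M d x y z l1 l2 l3"
  shows "rips_condition d l1 l2 l3 (triangle_delta d l1 l2 l3)"
    "\<And>\<delta>. rips_condition d l1 l2 l3 \<delta> \<Longrightarrow> triangle_delta d l1 l2 l3 \<le> \<delta>"
proof -
  note ne = rips_constants_nonempty_bdd_below[OF assms]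
  show "triangle_delta d l1 l2 l3 \<le> \<delta>" if "rips_condition d l1 l2 l3 \<delta>" for \<delta>
    unfolding triangle_delta_def using that by (intro cInf_lower ne(2)) simp
  have "a \<le> triangle_delta d l1 l2 l3" if "\<And>\<delta>. rips_condition d l1 l2 l3 \<delta> \<Longrightarrow> a \<le> \<delta>" for a
    unfolding triangle_delta_def using that by (intro cInf_greatest[OF ne(1)]) simp
  then show "rips_condition d l1 l2 l3 (triangle_delta d l1 l2 l3)"
    unfolding rips_condition_def[of _ _ _ _ "triangle_delta d l1 l2 l3"]
    by (auto simp: rips_condition_def)
qed

lemma rips_condition_relatively_slim:
  assumes "relatively_slim \<epsilon> M d" "is_triangle M d x y z l1 l2 l3"
  shows "rips_condition d l1 l2 l3 (\<epsilon> * perimeter d x y z)"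
proof -
  have t: "is_triangle M d x y z l1 l2 l3" "is_triangle M d y z x l2 l3 l1"
    "is_triangle M d z x y l3 l1 l2"
    using assms(2) by (auto simp: is_triangle_def)
  have per: "perimeter d y z x = perimeter d x y z" "perimeter d z x y = perimeter d x y z"
    by (simp_all add: perimeter_def)
  have *: "dist_to_set d p (k2 \<union> k3) \<le> \<epsilon> * perimeter d u v w"
    if k: "is_triangle M d u v w k1 k2 k3" "p \<in> k1" for u v w k1 k2 k3 p
  proof -
    obtain q where q: "q \<in> k2 \<union> k3" "d p q \<le> \<epsilon> * perimeter d u v w"
      using assms(1) k unfolding relatively_slim_def by blast
    show ?thesis using dist_to_set_le[OF q(1), of p] q(2) by linarith
  qed
  show ?thesis
    unfolding rips_condition_def using *[OF t(1)] *[OF t(2)] *[OF t(3)] per by simp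
qed

lemma relatively_slim_of_ratio_bound:
  assumes "\<And>r. r \<in> delta_ratios M d \<Longrightarrow> r \<le> \<epsilon>"
  shows "relatively_slim \<epsilon> M d"
  unfolding relatively_slim_def
proof (intro allI impI ballI)
  fix x y z l1 l2 l3 p
  assume t: "is_triangle M d x y z l1 l2 l3" and p: "p \<in> l1"
  then have s: "geodesic_segment M d x y l1" "geodesic_segment M d y z l2"
    "geodesic_segment M d z x l3" by (auto simp: is_triangle_def)
  have "perimeter d x y z \<ge> 0" by (simp add: perimeter_def)
  then have "triangle_delta d l1 l2 l3 \<le> \<epsilon> * perimeter d x y z"
  proof (cases "perimeter d x y z = 0")
    case True
    then show ?thesis using triangle_delta_least(2)[OF t rips_condition_perimeter[OF t]] by simp
  next
    case False
    then have "triangle_delta d l1 l2 l3 / perimeter d x y z \<le> \<epsilon>"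
      using assms t \<open>perimeter d x y z \<ge> 0\<close> unfolding delta_ratios_def by fastforce
    then show ?thesis using False \<open>perimeter d x y z \<ge> 0\<close> by (simp add: divide_le_eq)
  qed
  then have "dist_to_set d p (l2 \<union> l3) \<le> \<epsilon> * perimeter d x y z"
    using triangle_delta_least(1)[OF t] p unfolding rips_condition_def by force
  then show "\<exists>q\<in>l2 \<union> l3. d p q \<le> \<epsilon> * perimeter d x y z"
    using dist_to_set_Un_attained[OF s(2,3)] p geodesic_segment_in_carrier(1)[OF s(1)] by blast
qed

lemma ratio_bound_of_relatively_slim:
  assumes "relatively_slim \<epsilon> M d" "r \<in> delta_ratios M d"
  shows "r \<le> \<epsilon>"
proof -
  obtain x y z l1 l2 l3 where t: "is_triangle M d x y z l1 l2 l3" "perimeter d x y z > 0"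
    "r = triangle_delta d l1 l2 l3 / perimeter d x y z"
    using assms(2) unfolding delta_ratios_def by blast
  then show ?thesis
    using triangle_delta_least(2)[OF t(1) rips_condition_relatively_slim[OF assms(1) t(1)]]
    by (simp add: divide_le_eq)
qed

end

theorem theorem2:
  fixes M :: "'a set" and d :: "'a \<Rightarrow> 'a \<Rightarrow> real"
  assumes "Metric_space M d"
    and "geodesic_space M d"
  shows "real_tree M d \<longleftrightarrow> sup_delta_ratio M d < 1 / 32"
proof -
  interpret Metric_space M d by fact
  let ?\<epsilon> = "sup_delta_ratio M d"
  have upper: "r \<le> ?\<epsilon>" if "r \<in> delta_ratios M d" for r
    using that cSup_upper[OF that delta_ratios_bdd_above] by (auto simp: sup_delta_ratio_def)
  have least: "?\<epsilon> \<le> b" if "\<And>r. r \<in> delta_ratios M d \<Longrightarrow> r \<le> b" "0 \<le> b" for b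
    using that cSup_least[of "delta_ratios M d" b] by (auto simp: sup_delta_ratio_def)
  show ?thesis
  proof
    assume tree: "real_tree M d"
    have "r \<le> 0" if r: "r \<in> delta_ratios M d" for r
    proof -
      obtain x y z l1 l2 l3 where t: "is_triangle M d x y z l1 l2 l3" "perimeter d x y z > 0"
        "r = triangle_delta d l1 l2 l3 / perimeter d x y z"
        using r unfolding delta_ratios_def by blast
      have "rips_condition d l1 l2 l3 0"
        using tree t(1) unfolding real_tree_def hyperbolic_space_def by blast
      then have "triangle_delta d l1 l2 l3 \<le> 0" using triangle_delta_least(2)[OF t(1)] by blast
      then show ?thesis using t by (simp add: divide_le_0_iff)
    qed
    then have "?\<epsilon> \<le> 0" by (intro least) auto
    then show "?\<epsilon> < 1 / 32" by simp
  next
    assume small: "?\<epsilon> < 1 / 32"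
    have nn: "0 \<le> ?\<epsilon>"
    proof (cases "delta_ratios M d = {}")
      case False
      then obtain r where "r \<in> delta_ratios M d" by blast
      then show ?thesis using delta_ratios_bounds(1)[of r] upper[of r] by linarith
    qed (simp add: sup_delta_ratio_def)
    have slim: "relatively_slim ?\<epsilon> M d" by (rule relatively_slim_of_ratio_bound[OF upper])
    have "relatively_slim (7 / 8 * ?\<epsilon>) M d"
      using relatively_slim_improve[OF assms(2) slim nn] small by simp
    then have "?\<epsilon> \<le> 7 / 8 * ?\<epsilon>"
      using nn by (intro least) (auto dest: ratio_bound_of_relatively_slim)
    then have "?\<epsilon> = 0" using nn by simp
    then have "rips_condition d l1 l2 l3 0" if "is_triangle M d x y z l1 l2 l3" for x y z l1 l2 l3
      using rips_condition_relatively_slim[OF slim that] by simp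
    then show "real_tree M d"
      unfolding real_tree_def hyperbolic_space_def using assms(2) by blast
  qed
qed

end
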